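(* Let $\Gamma=(V,E)$ be a finite simple graph. The regular $\mathcal{J}$-classes of $\operatorname{St}(\Gamma)$ form a chain $$J_0<J_1<J_2<\dots<J_k,$$ where $k$ is the largest rank of an element of $\operatorname{St}(\Gamma)$ satisfying the Transversal Condition and the Covering Condition. Two regular elements $f,g\in\operatorname{St}(\Gamma)$ belong to the same $\mathcal{J}$-class if and only if their underlying matchings have the same size, i.e. $|M_f|=|M_g|$.
   Context: For a finite simple graph $\Gamma=(V,E)$, the simplices are the singletons $\{v\}$ and the edges. A partial function $f:V\to V$ (acting on the right, composed left to right) is continuous if for every simplex $\sigma$ the full preimage $\sigma f^{-1}$ is a simplex or empty. $\operatorname{St}(\Gamma)$ is the semigroup of all continuous partial functions $f$ such that every vertex fiber $vf^{-1}$ is an edge or empty. Equivalently, $\operatorname{Dom}(f)$ is the union of the edges of a matching $M_f=\{E_1,\dots,E_r\}$, $\operatorname{Im}(f)=\{v_1,\dots,v_r\}$ is an independent set of size $r$, and both endpoints of $E_i$ are mapped to $v_i$; the rank of $f$ is $r=|\operatorname{Im}(f)|$. Such an $f$ satisfies the Transversal Condition if there is an independent set $\{u_1,\dots,u_r\}$ with $u_i\in E_i$ for all $i$, and the Covering Condition if there is a matching $\{E'_1,\dots,E'_r\}$ of size $r$ in $\Gamma$ with $v_i\in E'_i$ for all $i$. A regular $\mathcal{J}$-class of a semigroup $S$ is one containing a regular element ($a=aba$ for some $b\in S$); $\mathcal{J}$-classes are ordered by $J_a\le J_b\iff S^1aS^1\subseteq S^1bS^1$. *)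

theory Defs
  imports "HOL-Library.Ramsey" "HOL-Library.Disjoint_Sets"
begin

section \<open>Semigroups given by a carrier and a product\<close>

text \<open>
  Throughout, \<open>S\<close> is a carrier set closed under the associative product \<open>m\<close>.
  The set \<open>principal_ideal S m a\<close> is $S^1 a S^1$, with the products involving the
  adjoined identity written out.
\<close>

definition principal_ideal :: "'s set \<Rightarrow> ('s \<Rightarrow> 's \<Rightarrow> 's) \<Rightarrow> 's \<Rightarrow> 's set" where
  "principal_ideal S m a =
     {a} \<union> {m s a | s. s \<in> S} \<union> {m a t | t. t \<in> S} \<union> {m (m s a) t | s t. s \<in> S \<and> t \<in> S}"

definition J_class :: "'s set \<Rightarrow> ('s \<Rightarrow> 's \<Rightarrow> 's) \<Rightarrow> 's \<Rightarrow> 's set" where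
  "J_class S m a = {b \<in> S. principal_ideal S m b = principal_ideal S m a}"

definition J_class_le :: "'s set \<Rightarrow> ('s \<Rightarrow> 's \<Rightarrow> 's) \<Rightarrow> 's set \<Rightarrow> 's set \<Rightarrow> bool" where
  "J_class_le S m A B \<longleftrightarrow>
     (\<exists>a\<in>S. \<exists>b\<in>S. A = J_class S m a \<and> B = J_class S m b \<and>
        principal_ideal S m a \<subseteq> principal_ideal S m b)"

definition J_class_less :: "'s set \<Rightarrow> ('s \<Rightarrow> 's \<Rightarrow> 's) \<Rightarrow> 's set \<Rightarrow> 's set \<Rightarrow> bool" where
  "J_class_less S m A B \<longleftrightarrow> J_class_le S m A B \<and> A \<noteq> B"

definition regular_element :: "'s set \<Rightarrow> ('s \<Rightarrow> 's \<Rightarrow> 's) \<Rightarrow> 's \<Rightarrow> bool" where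
  "regular_element S m a \<longleftrightarrow> a \<in> S \<and> (\<exists>b\<in>S. a = m (m a b) a)"

definition regular_J_classes :: "'s set \<Rightarrow> ('s \<Rightarrow> 's \<Rightarrow> 's) \<Rightarrow> 's set set" where
  "regular_J_classes S m =
     {C. (\<exists>a\<in>S. C = J_class S m a) \<and> (\<exists>c\<in>C. regular_element S m c)}"

section \<open>Finite simple graphs\<close>

definition finite_simple_graph :: "'a set \<Rightarrow> 'a set set \<Rightarrow> bool" where
  "finite_simple_graph V E \<longleftrightarrow> finite V \<and> E \<subseteq> [V]\<^bsup>2\<^esup>"

definition simplices :: "'a set \<Rightarrow> 'a set set \<Rightarrow> 'a set set" where
  "simplices V E = {{v} | v. v \<in> V} \<union> E"

definition independent_set :: "'a set \<Rightarrow> 'a set set \<Rightarrow> 'a set \<Rightarrow> bool" where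
  "independent_set V E A \<longleftrightarrow> A \<subseteq> V \<and> indep A E"

definition matching :: "'a set set \<Rightarrow> 'a set set \<Rightarrow> bool" where
  "matching E M \<longleftrightarrow> M \<subseteq> E \<and> disjoint M"

section \<open>The semigroup of continuous partial functions with edge fibers\<close>

definition preimage :: "('a \<rightharpoonup> 'a) \<Rightarrow> 'a set \<Rightarrow> 'a set" where
  "preimage f A = {x. \<exists>y\<in>A. f x = Some y}"

definition continuous_partial :: "'a set \<Rightarrow> 'a set set \<Rightarrow> ('a \<rightharpoonup> 'a) \<Rightarrow> bool" where
  "continuous_partial V E f \<longleftrightarrow> dom f \<subseteq> V \<and> ran f \<subseteq> V \<and>
     (\<forall>\<sigma>\<in>simplices V E. preimage f \<sigma> \<in> simplices V E \<or> preimage f \<sigma> = {})"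

definition St :: "'a set \<Rightarrow> 'a set set \<Rightarrow> ('a \<rightharpoonup> 'a) set" where
  "St V E = {f. continuous_partial V E f \<and>
     (\<forall>v\<in>V. preimage f {v} \<in> E \<or> preimage f {v} = {})}"

text \<open>Partial functions act on the right, so \<open>f\<close> is applied first in \<open>rcomp f g\<close>.\<close>

definition rcomp :: "('a \<rightharpoonup> 'a) \<Rightarrow> ('a \<rightharpoonup> 'a) \<Rightarrow> ('a \<rightharpoonup> 'a)" where
  "rcomp f g = g \<circ>\<^sub>m f"

definition rank :: "('a \<rightharpoonup> 'a) \<Rightarrow> nat" where
  "rank f = card (ran f)"

text \<open>The matching $M_f$ consists of the nonempty vertex fibers.\<close>

definition underlying_matching :: "('a \<rightharpoonup> 'a) \<Rightarrow> 'a set set" where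
  "underlying_matching f = (\<lambda>v. preimage f {v}) ` ran f"

text \<open>
  The points \<open>v\<^sub>i\<close> of \<open>ran f\<close> serve as the indices in the next two
  conditions, the edge \<open>E\<^sub>i\<close> being the fiber of \<open>v\<^sub>i\<close>.
\<close>

definition transversal_condition :: "'a set \<Rightarrow> 'a set set \<Rightarrow> ('a \<rightharpoonup> 'a) \<Rightarrow> bool" where
  "transversal_condition V E f \<longleftrightarrow>
     (\<exists>u. (\<forall>v\<in>ran f. u v \<in> preimage f {v}) \<and> independent_set V E (u ` ran f))"

definition covering_condition :: "'a set set \<Rightarrow> ('a \<rightharpoonup> 'a) \<Rightarrow> bool" where
  "covering_condition E f \<longleftrightarrow>
     (\<exists>e. (\<forall>v\<in>ran f. v \<in> e v) \<and> matching E (e ` ran f) \<and> card (e ` ran f) = rank f)"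

definition TC_CC_ranks :: "'a set \<Rightarrow> 'a set set \<Rightarrow> nat set" where
  "TC_CC_ranks V E =
     {rank f | f. f \<in> St V E \<and> transversal_condition V E f \<and> covering_condition E f}"

section \<open>Basic properties\<close>

lemma edge_nonempty:
  assumes "finite_simple_graph V E" "e \<in> E" shows "e \<noteq> {}"
  using assms by (auto simp: finite_simple_graph_def nsets_def)

lemma preimage_ran_nonempty: "preimage f {v} \<noteq> {} \<longleftrightarrow> v \<in> ran f"
  by (auto simp: preimage_def ran_def)

lemma preimage_insert: "preimage f (insert u A) = preimage f {u} \<union> preimage f A"
  by (auto simp: preimage_def)

lemma preimage_disjoint: "u \<noteq> v \<Longrightarrow> preimage f {u} \<inter> preimage f {v} = {}"
  by (auto simp: preimage_def)

lemma rcomp_assoc: "rcomp (rcomp f g) h = rcomp f (rcomp g h)"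
  by (simp add: rcomp_def map_comp_def fun_eq_iff split: option.split)

lemma preimage_rcomp: "preimage (rcomp f g) A = preimage f (preimage g A)"
  by (auto simp: preimage_def rcomp_def map_comp_def split: option.splits)

lemma edge_doubleton:
  assumes "finite_simple_graph V E" "e \<in> E"
  obtains a b where "e = {a, b}" "a \<noteq> b" "a \<in> V" "b \<in> V"
proof -
  have "e \<subseteq> V" "card e = 2"
    using assms by (auto simp: finite_simple_graph_def nsets_def)
  then show ?thesis
    using that by (auto simp: card_2_iff)
qed

lemma St_preimage_edge:
  assumes G: "finite_simple_graph V E" and f: "f \<in> St V E" and e: "e \<in> E"
  shows "preimage f e \<in> E \<or> preimage f e = {}"
proof (rule ccontr)
  assume neg: "\<not> ?thesis"
  have "preimage f e \<in> simplices V E \<or> preimage f e = {}"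
    using f e by (auto simp: St_def continuous_partial_def simplices_def)
  with neg obtain w where w: "preimage f e = {w}"
    by (auto simp: simplices_def)
  obtain a b where ab: "e = {a, b}" "a \<in> V" "b \<in> V"
    using edge_doubleton[OF G e] by metis
  have split: "preimage f e = preimage f {a} \<union> preimage f {b}"
    using ab preimage_insert by metis
  have card2: "d \<in> E \<Longrightarrow> card d = 2" for d
    using G by (auto simp: finite_simple_graph_def nsets_def)
  have fib: "preimage f {x} = {}" if x: "x \<in> V" "preimage f {x} \<subseteq> {w}" for x
  proof (rule ccontr)
    assume "preimage f {x} \<noteq> {}"
    then have "preimage f {x} \<in> E"
      using f x by (auto simp: St_def)
    then have "card (preimage f {x}) = 2"
      by (rule card2)
    moreover have "card (preimage f {x}) \<le> card {w}"
      by (rule card_mono) (use x in auto)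
    ultimately show False
      by simp
  qed
  have "preimage f {a} = {}" "preimage f {b} = {}"
    using fib ab split w by auto
  then show False
    using split w by simp
qed

lemma St_closed:
  assumes G: "finite_simple_graph V E" and f: "f \<in> St V E" and g: "g \<in> St V E"
  shows "rcomp f g \<in> St V E"
proof -
  have dr: "dom (rcomp f g) \<subseteq> V" "ran (rcomp f g) \<subseteq> V"
  proof -
    have "dom f \<subseteq> V" "ran g \<subseteq> V"
      using f g by (simp_all add: St_def continuous_partial_def)
    moreover have "dom (rcomp f g) \<subseteq> dom f" "ran (rcomp f g) \<subseteq> ran g"
      by (auto simp: rcomp_def map_comp_def dom_def ran_def split: option.splits)
    ultimately show "dom (rcomp f g) \<subseteq> V" "ran (rcomp f g) \<subseteq> V"
      by auto
  qed
  have g1: "preimage g s \<in> E \<or> preimage g s = {}" if "s \<in> simplices V E" for s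
    using that g St_preimage_edge[OF G g] by (auto simp: simplices_def St_def)
  have empty: "preimage f {} = {}"
    by (simp add: preimage_def)
  have key: "preimage (rcomp f g) s \<in> E \<or> preimage (rcomp f g) s = {}"
    if "s \<in> simplices V E" for s
    using g1[OF that] St_preimage_edge[OF G f] empty by (metis preimage_rcomp)
  then show ?thesis
    using dr by (auto simp: St_def continuous_partial_def simplices_def)
qed

lemma dom_underlying_matching: "dom f = \<Union>(underlying_matching f)"
  by (auto simp: underlying_matching_def preimage_def ran_def)

lemma card_underlying_matching: "card (underlying_matching f) = rank f"
  unfolding underlying_matching_def rank_def
proof (rule card_image, rule inj_onI)
  fix u v assume "u \<in> ran f" "v \<in> ran f" "preimage f {u} = preimage f {v}"
  then show "u = v"
    using preimage_disjoint[of u v f] preimage_ran_nonempty[of f u] by auto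
qed

theorem St_iff_matching:
  assumes G: "finite_simple_graph V E"
  shows "f \<in> St V E \<longleftrightarrow>
    matching E (underlying_matching f) \<and> independent_set V E (ran f)"
proof
  assume f: "f \<in> St V E"
  have "ran f \<subseteq> V"
    using f by (simp add: St_def continuous_partial_def)
  then have fib: "preimage f {v} \<in> E" if "v \<in> ran f" for v
    using f that preimage_ran_nonempty[of f v] by (auto simp: St_def)
  have "matching E (underlying_matching f)"
    unfolding matching_def disjoint_def
  proof (intro conjI ballI impI)
    show "underlying_matching f \<subseteq> E"
      using fib by (auto simp: underlying_matching_def)
  next
    fix a b assume "a \<in> underlying_matching f" "b \<in> underlying_matching f" "a \<noteq> b"
    then obtain u v where "a = preimage f {u}" "b = preimage f {v}" "u \<noteq> v"
      by (auto simp: underlying_matching_def)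
    then show "a \<inter> b = {}"
      by (simp add: preimage_disjoint)
  qed
  moreover have "{u, v} \<notin> E" if uv: "u \<in> ran f" "v \<in> ran f" "u \<noteq> v" for u v
  proof
    assume "{u, v} \<in> E"
    then have "preimage f {u} \<union> preimage f {v} \<in> E"
      using St_preimage_edge[OF G f, of "{u, v}"] preimage_insert[of f u "{v}"]
        preimage_ran_nonempty[of f u] uv by auto
    moreover have "card d = 2 \<and> finite d" if "d \<in> E" for d
      using G that by (auto simp: finite_simple_graph_def nsets_def)
    moreover have "card (preimage f {u} \<union> preimage f {v}) =
        card (preimage f {u}) + card (preimage f {v})"
      by (rule card_Un_disjoint)
        (use calculation(2) fib uv preimage_disjoint[OF uv(3)] in auto)
    ultimately have "(2::nat) = 2 + 2"
      using fib[OF uv(1)] fib[OF uv(2)] by metis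
    then show False
      by simp
  qed
  ultimately show "matching E (underlying_matching f) \<and> independent_set V E (ran f)"
    using \<open>ran f \<subseteq> V\<close> by (auto simp: independent_set_def indep_def)
next
  assume "matching E (underlying_matching f) \<and> independent_set V E (ran f)"
  then have M: "underlying_matching f \<subseteq> E" and R: "ran f \<subseteq> V" "indep (ran f) E"
    by (auto simp: matching_def independent_set_def)
  have fib: "preimage f {v} \<in> E \<or> preimage f {v} = {}" for v
    using M preimage_ran_nonempty[of f v] by (auto simp: underlying_matching_def)
  have edge: "preimage f e \<in> E \<or> preimage f e = {}" if e: "e \<in> E" for e
  proof -
    obtain a b where ab: "e = {a, b}" "a \<noteq> b"
      using edge_doubleton[OF G e] by metis
    then have "a \<notin> ran f \<or> b \<notin> ran f"
      using R e by (auto simp: indep_def)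
    then have "preimage f {a} = {} \<or> preimage f {b} = {}"
      using preimage_ran_nonempty by metis
    moreover have "preimage f e = preimage f {a} \<union> preimage f {b}"
      using ab preimage_insert by metis
    ultimately show ?thesis
      using fib[of a] fib[of b] by auto
  qed
  have "dom f \<subseteq> V"
    using M G unfolding dom_underlying_matching finite_simple_graph_def nsets_def by blast
  moreover have "preimage f \<sigma> \<in> simplices V E \<or> preimage f \<sigma> = {}"
    if "\<sigma> \<in> simplices V E" for \<sigma>
    using that fib edge unfolding simplices_def by blast
  ultimately show "f \<in> St V E"
    using R fib by (simp add: St_def continuous_partial_def)
qed

lemma empty_in_St: "Map.empty \<in> St V E"
  by (auto simp: St_def continuous_partial_def preimage_def)

lemma zero_in_TC_CC_ranks: "0 \<in> TC_CC_ranks V E"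
proof -
  have "transversal_condition V E Map.empty"
    by (simp add: transversal_condition_def independent_set_def indep_def)
  moreover have "covering_condition E Map.empty"
    by (simp add: covering_condition_def matching_def rank_def)
  moreover have "rank Map.empty = 0"
    by (simp add: rank_def)
  ultimately show ?thesis
    unfolding TC_CC_ranks_def using empty_in_St by (metis (mono_tags, lifting) mem_Collect_eq)
qed

lemma finite_TC_CC_ranks:
  assumes "finite V" shows "finite (TC_CC_ranks V E)"
proof (rule finite_subset)
  show "TC_CC_ranks V E \<subseteq> {..card V}"
    using assms by (auto simp: TC_CC_ranks_def rank_def St_def continuous_partial_def
        intro: card_mono)
qed simp

end

theory Submission
  imports Defs
begin

text \<open>
  The proof compares everything with the rank. If \<open>g = g h g\<close>, then \<open>h\<close> chooses a point in
  every vertex fiber of \<open>g\<close>; since \<open>h\<close> itself lies in the semigroup, the chosen points form an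
  independent set and the \<open>h\<close>-fibers over them form a matching that covers \<open>ran g\<close>. Conversely
  a transversal and a covering matching can be glued to such an \<open>h\<close>. Hence the
  regular elements are exactly those satisfying the Transversal and the Covering Condition
  (\<open>regular_iff_conditions\<close>).

  The central fact is \<open>factor_through_regular\<close>: a regular \<open>g\<close> is a factor of every element
  \<open>f\<close> of rank at most the rank of \<open>g\<close>. One sends the fibers of \<open>f\<close> to different points of
  the transversal of \<open>g\<close>, applies \<open>g\<close>, and sends the edges covering the resulting points of \<open>ran g\<close>
  to the points of \<open>ran f\<close>. Multiplication never raises the rank, so on regular
  elements the order of principal ideals is the order of the ranks; as the rank of \<open>f\<close> is the
  size of its matching, this describes the regular $\mathcal{J}$-classes and shows that they form a
  chain. The chain has no gaps, because the restriction of a regular element to some of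
  its fibers is again regular (\<open>regular_of_smaller_rank\<close>).
\<close>

section \<open>Principal ideals\<close>

lemma principal_ideal_refl: "a \<in> principal_ideal S m a"
  by (simp add: principal_ideal_def)

lemma principal_ideal_mono:
  assumes closed: "\<And>x y. x \<in> S \<Longrightarrow> y \<in> S \<Longrightarrow> m x y \<in> S"
    and assoc: "\<And>x y z. m (m x y) z = m x (m y z)"
    and b: "b \<in> principal_ideal S m a"
  shows "principal_ideal S m b \<subseteq> principal_ideal S m a"
proof -
  let ?I = "principal_ideal S m a"
  have mem: "a \<in> ?I" "\<And>s. s \<in> S \<Longrightarrow> m s a \<in> ?I" "\<And>t. t \<in> S \<Longrightarrow> m a t \<in> ?I"
    "\<And>s t. s \<in> S \<Longrightarrow> t \<in> S \<Longrightarrow> m s (m a t) \<in> ?I"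
    by (auto simp: principal_ideal_def assoc)
  have cases: thesis
    if "c \<in> ?I" "c = a \<Longrightarrow> thesis" "\<And>s. s \<in> S \<Longrightarrow> c = m s a \<Longrightarrow> thesis"
      "\<And>t. t \<in> S \<Longrightarrow> c = m a t \<Longrightarrow> thesis"
      "\<And>s t. s \<in> S \<Longrightarrow> t \<in> S \<Longrightarrow> c = m s (m a t) \<Longrightarrow> thesis" for c thesis
    using that by (auto simp: principal_ideal_def assoc)
  have left: "m s c \<in> ?I" if s: "s \<in> S" and c: "c \<in> ?I" for s c
    using c
  proof (rule cases)
    fix s' assume "s' \<in> S" "c = m s' a"
    then show ?thesis
      using mem(2)[OF closed[OF s]] by (simp add: assoc)
  next
    fix s' t assume "s' \<in> S" "t \<in> S" "c = m s' (m a t)"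
    then show ?thesis
      using mem(4)[OF closed[OF s]] by (simp add: assoc)
  qed (use s mem in simp_all)
  have right: "m c t \<in> ?I" if t: "t \<in> S" and c: "c \<in> ?I" for t c
    using c by (rule cases) (use t mem closed in \<open>simp_all add: assoc\<close>)
  show ?thesis
    using b left right by (auto simp: principal_ideal_def[of S m b])
qed

section \<open>Gluing a matching to an independent set\<close>

text \<open>
  The index set \<open>I\<close> labels both the edges \<open>e i\<close> and the points \<open>p i\<close>. For an injectively labelled
  matching the choice below is forced, since a vertex lies in at most one edge.
\<close>

definition matching_map :: "'i set \<Rightarrow> ('i \<Rightarrow> 'a set) \<Rightarrow> ('i \<Rightarrow> 'b) \<Rightarrow> ('a \<rightharpoonup> 'b)" where
  "matching_map I e p x =
     (if \<exists>i\<in>I. x \<in> e i then Some (p (SOME i. i \<in> I \<and> x \<in> e i)) else None)"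

lemma matching_map_Some_iff:
  assumes "inj_on e I" "disjoint (e ` I)"
  shows "matching_map I e p x = Some y \<longleftrightarrow> (\<exists>i\<in>I. x \<in> e i \<and> y = p i)"
proof -
  have "(SOME j. j \<in> I \<and> x \<in> e j) = i" if "i \<in> I" "x \<in> e i" for i
  proof (rule some_equality)
    fix j assume "j \<in> I \<and> x \<in> e j"
    with that assms show "j = i"
      by (meson disjnt_iff disjoint_image_disjoint_family_on disjoint_family_on_def disjoint_iff)
  qed (use that in simp)
  then show ?thesis
    by (auto simp: matching_map_def)
qed

text \<open>
  Every element constructed in the proof is such a glued map. Injectivity of \<open>p\<close> keeps the edges
  apart: it makes the vertex fibers the single edges \<open>e i\<close> and not unions of several edges.
\<close>

lemma
  assumes G: "finite_simple_graph V E"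
    and e: "inj_on e I" "matching E (e ` I)"
    and p: "inj_on p I" "independent_set V E (p ` I)"
  shows matching_map_in_St: "matching_map I e p \<in> St V E"
    and ran_matching_map: "ran (matching_map I e p) = p ` I"
proof -
  have Some_iff: "matching_map I e p x = Some y \<longleftrightarrow> (\<exists>i\<in>I. x \<in> e i \<and> y = p i)" for x y
    using e by (intro matching_map_Some_iff) (simp_all add: matching_def)
  have nonempty: "e i \<noteq> {}" if "i \<in> I" for i
    using that e(2) edge_nonempty[OF G] by (auto simp: matching_def)
  show ran: "ran (matching_map I e p) = p ` I"
    using nonempty by (fastforce simp: ran_def Some_iff)
  have "preimage (matching_map I e p) {p i} = e i" if "i \<in> I" for i
    using that p(1) by (auto simp: preimage_def Some_iff inj_on_def)
  then have "underlying_matching (matching_map I e p) = e ` I"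
    by (force simp: underlying_matching_def ran)
  then show "matching_map I e p \<in> St V E"
    using e(2) p(2) ran by (simp add: St_iff_matching[OF G])
qed

lemma fibers_labelled_matching:
  assumes G: "finite_simple_graph V E" and f: "f \<in> St V E" and A: "A \<subseteq> ran f"
  shows "inj_on (\<lambda>v. preimage f {v}) A" "matching E ((\<lambda>v. preimage f {v}) ` A)"
proof -
  show "inj_on (\<lambda>v. preimage f {v}) A"
  proof (rule inj_onI)
    fix u v assume "u \<in> A" "preimage f {u} = preimage f {v}"
    then show "u = v"
      using A preimage_disjoint[of u v f] preimage_ran_nonempty[of f u] by auto
  qed
  have "(\<lambda>v. preimage f {v}) ` A \<subseteq> underlying_matching f"
    using A by (auto simp: underlying_matching_def)
  then show "matching E ((\<lambda>v. preimage f {v}) ` A)"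
    using f unfolding St_iff_matching[OF G] matching_def
    by (auto intro: pairwise_subset)
qed

lemma independent_set_subset:
  "independent_set V E B \<Longrightarrow> A \<subseteq> B \<Longrightarrow> independent_set V E A"
  by (auto simp: independent_set_def indep_def)

lemma St_independent_ran:
  assumes "finite_simple_graph V E" "f \<in> St V E" "A \<subseteq> ran f"
  shows "independent_set V E A"
  using assms independent_set_subset by (auto simp: St_iff_matching)

lemma St_finite_ran:
  assumes "finite_simple_graph V E" "f \<in> St V E"
  shows "finite (ran f)"
  using assms by (auto simp: finite_simple_graph_def St_def continuous_partial_def
      intro: finite_subset)

section \<open>Regular elements\<close>

text \<open>
  Evaluated at a point of the fiber of \<open>v\<close>, the equation \<open>f = f h f\<close> says that \<open>h\<close> sends
  \<open>v\<close> back into this fiber, so it expresses that \<open>h\<close> is a section of \<open>f\<close> over \<open>ran f\<close>.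
\<close>

lemma regular_iff_section:
  "regular_element (St V E) rcomp f \<longleftrightarrow>
     f \<in> St V E \<and> (\<exists>h\<in>St V E. \<forall>v\<in>ran f. \<exists>u. h v = Some u \<and> f u = Some v)"
proof -
  have "f = rcomp (rcomp f h) f \<longleftrightarrow> (\<forall>v\<in>ran f. \<exists>u. h v = Some u \<and> f u = Some v)" for h
  proof
    assume eq: "f = rcomp (rcomp f h) f"
    show "\<forall>v\<in>ran f. \<exists>u. h v = Some u \<and> f u = Some v"
    proof
      fix v assume "v \<in> ran f"
      then obtain x where x: "f x = Some v"
        by (auto simp: ran_def)
      have "rcomp (rcomp f h) f x = Some v"
        using eq x by simp
      then show "\<exists>u. h v = Some u \<and> f u = Some v"
        using x by (auto simp: rcomp_def map_comp_def split: option.splits)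
    qed
  next
    assume sec: "\<forall>v\<in>ran f. \<exists>u. h v = Some u \<and> f u = Some v"
    show "f = rcomp (rcomp f h) f"
    proof
      fix x
      show "f x = rcomp (rcomp f h) f x"
      proof (cases "f x")
        case (Some v)
        then obtain u where "h v = Some u" "f u = Some v"
          using sec by (meson ranI)
        then show ?thesis
          using Some by (simp add: rcomp_def map_comp_def)
      qed (simp add: rcomp_def map_comp_def)
    qed
  qed
  then show ?thesis
    by (simp add: regular_element_def)
qed

text \<open>
  A section of \<open>f\<close> inside the semigroup is the same thing as a transversal of the fibers (its
  values) together with a covering matching (its fibers).
\<close>

lemma regular_iff_conditions:
  assumes G: "finite_simple_graph V E"
  shows "regular_element (St V E) rcomp f \<longleftrightarrow>
    f \<in> St V E \<and> transversal_condition V E f \<and> covering_condition E f"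
proof
  assume "regular_element (St V E) rcomp f"
  then obtain h where f: "f \<in> St V E" and h: "h \<in> St V E"
    and sec: "\<forall>v\<in>ran f. \<exists>u. h v = Some u \<and> f u = Some v"
    unfolding regular_iff_section by blast
  from bchoice[OF sec] obtain u where u: "\<forall>v\<in>ran f. h v = Some (u v) \<and> f (u v) = Some v"
    by blast
  have sub: "u ` ran f \<subseteq> ran h"
    using u ranI[of h] by blast
  have inj: "inj_on u (ran f)"
  proof (rule inj_onI)
    fix v w assume "v \<in> ran f" "w \<in> ran f" "u v = u w"
    then show "v = w"
      using u by (metis option.inject)
  qed
  have "transversal_condition V E f"
    unfolding transversal_condition_def
    using u St_independent_ran[OF G h sub] by (intro exI[of _ u]) (simp add: preimage_def)
  moreover have "covering_condition E f"
    unfolding covering_condition_def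
  proof (intro exI[of _ "\<lambda>v. preimage h {u v}"] conjI)
    show "\<forall>v\<in>ran f. v \<in> preimage h {u v}"
      using u by (simp add: preimage_def)
    note fibers = fibers_labelled_matching[OF G h sub]
    show "matching E ((\<lambda>v. preimage h {u v}) ` ran f)"
      using fibers(2) by (simp add: image_image)
    have "inj_on (\<lambda>v. preimage h {u v}) (ran f)"
      using comp_inj_on[OF inj fibers(1)] by (simp add: comp_def)
    then show "card ((\<lambda>v. preimage h {u v}) ` ran f) = rank f"
      by (simp add: card_image rank_def)
  qed
  ultimately show "f \<in> St V E \<and> transversal_condition V E f \<and> covering_condition E f"
    using f by simp
next
  assume "f \<in> St V E \<and> transversal_condition V E f \<and> covering_condition E f"
  then obtain u e where f: "f \<in> St V E"
    and u: "\<forall>v\<in>ran f. u v \<in> preimage f {v}" "independent_set V E (u ` ran f)"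
    and e: "\<forall>v\<in>ran f. v \<in> e v" "matching E (e ` ran f)" "card (e ` ran f) = rank f"
    unfolding transversal_condition_def covering_condition_def by blast
  have inj_u: "inj_on u (ran f)"
  proof (rule inj_onI)
    fix v w assume vw: "v \<in> ran f" "w \<in> ran f" and eq: "u v = u w"
    have "f (u v) = Some v" "f (u w) = Some w"
      using u(1) vw by (simp_all add: preimage_def)
    then show "v = w"
      unfolding eq by simp
  qed
  have inj_e: "inj_on e (ran f)"
    using e(3) St_finite_ran[OF G f] by (simp add: rank_def eq_card_imp_inj_on)
  let ?h = "matching_map (ran f) e u"
  have "?h \<in> St V E"
    by (rule matching_map_in_St[OF G inj_e e(2) inj_u u(2)])
  moreover have "?h x = Some y \<longleftrightarrow> (\<exists>v\<in>ran f. x \<in> e v \<and> y = u v)" for x y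
    using inj_e e(2) by (intro matching_map_Some_iff) (simp_all add: matching_def)
  then have "?h v = Some (u v)" if "v \<in> ran f" for v
    using that e(1) by blast
  moreover have "f (u v) = Some v" if "v \<in> ran f" for v
    using that u(1) by (simp add: preimage_def)
  ultimately show "regular_element (St V E) rcomp f"
    using f unfolding regular_iff_section by blast
qed

text \<open>
  Restricting \<open>f\<close> to some of its fibers preserves regularity, because a section of \<open>f\<close> is
  also a section of the restriction.
\<close>

lemma regular_of_smaller_rank:
  assumes G: "finite_simple_graph V E"
    and f: "regular_element (St V E) rcomp f" and n: "n \<le> rank f"
  shows "\<exists>g. regular_element (St V E) rcomp g \<and> rank g = n"
proof -
  obtain h where fS: "f \<in> St V E" and h: "h \<in> St V E"
    and sec: "\<forall>v\<in>ran f. \<exists>u. h v = Some u \<and> f u = Some v"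
    using f unfolding regular_iff_section by blast
  obtain A where A: "A \<subseteq> ran f" "card A = n"
    using n obtain_subset_with_card_n unfolding rank_def by metis
  note fibers = fibers_labelled_matching[OF G fS A(1)]
  have ind: "independent_set V E ((\<lambda>v. v) ` A)"
    using St_independent_ran[OF G fS A(1)] by simp
  let ?g = "matching_map A (\<lambda>v. preimage f {v}) (\<lambda>v. v)"
  have ran: "ran ?g = A"
    using ran_matching_map[OF G fibers _ ind] by simp
  have "?g x = Some y \<longleftrightarrow> (\<exists>v\<in>A. x \<in> preimage f {v} \<and> y = v)" for x y
    using fibers by (intro matching_map_Some_iff) (simp_all add: matching_def)
  then have "?g u = Some v" if "v \<in> A" "f u = Some v" for u v
    using that by (auto simp: preimage_def)
  then have "regular_element (St V E) rcomp ?g"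
    unfolding regular_iff_section ran
    using matching_map_in_St[OF G fibers inj_on_id2 ind] h sec A(1) by blast
  then show ?thesis
    using A(2) ran by (auto simp: rank_def)
qed

section \<open>Rank and the order of principal ideals\<close>

lemma rank_rcomp_le:
  assumes "finite (ran f)" "finite (ran g)"
  shows "rank (rcomp f g) \<le> rank f" "rank (rcomp f g) \<le> rank g"
proof -
  have "ran (rcomp f g) \<subseteq> (\<lambda>v. the (g v)) ` ran f"
    by (force simp: rcomp_def map_comp_def ran_def split: option.splits)
  then show "rank (rcomp f g) \<le> rank f"
    unfolding rank_def using assms(1) by (meson card_image_le card_mono finite_imageI le_trans)
  have "ran (rcomp f g) \<subseteq> ran g"
    by (auto simp: rcomp_def map_comp_def ran_def split: option.splits)
  then show "rank (rcomp f g) \<le> rank g"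
    unfolding rank_def using assms(2) by (rule card_mono[rotated])
qed

lemma rank_le_of_mem_principal_ideal:
  assumes G: "finite_simple_graph V E"
    and g: "g \<in> St V E" and f: "f \<in> principal_ideal (St V E) rcomp g"
  shows "rank f \<le> rank g"
proof -
  have "rank (rcomp x y) \<le> rank x \<and> rank (rcomp x y) \<le> rank y"
    if "x \<in> St V E" "y \<in> St V E" for x y
    using rank_rcomp_le[of x y] that St_finite_ran[OF G] by blast
  then show ?thesis
    using f g St_closed[OF G] unfolding principal_ideal_def by auto (meson le_trans)
qed

text \<open>
  Sections \<open>h\<close> of \<open>g\<close> provide enough room to the left and to the right of \<open>g\<close>: the points
  \<open>h w\<close> are an independent set of possible images for the left factor, and the fibers of
  \<open>h\<close> are a matching from which the right factor can be built.
\<close>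

lemma factor_through_regular:
  assumes G: "finite_simple_graph V E"
    and f: "f \<in> St V E" and g: "regular_element (St V E) rcomp g"
    and le: "rank f \<le> rank g"
  shows "\<exists>s\<in>St V E. \<exists>t\<in>St V E. f = rcomp (rcomp s g) t"
proof -
  obtain h where gS: "g \<in> St V E" and h: "h \<in> St V E"
    and sec: "\<forall>w\<in>ran g. \<exists>u. h w = Some u \<and> g u = Some w"
    using g unfolding regular_iff_section by blast
  obtain \<phi> where \<phi>: "\<phi> ` ran f \<subseteq> ran g" "inj_on \<phi> (ran f)"
    using card_le_inj[OF St_finite_ran[OF G f] St_finite_ran[OF G gS]] le
    by (auto simp: rank_def)
  \<comment> \<open>The element \<open>f\<close> will be computed along \<open>x \<mapsto> q v \<mapsto> \<phi> v \<mapsto> v\<close> for \<open>x\<close> in the fiber of \<open>v\<close>.\<close>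
  define q where "q v = the (h (\<phi> v))" for v
  have q: "h (\<phi> v) = Some (q v)" "g (q v) = Some (\<phi> v)" if "v \<in> ran f" for v
  proof -
    have "\<phi> v \<in> ran g"
      using \<phi>(1) that by blast
    then obtain u where "h (\<phi> v) = Some u" "g u = Some (\<phi> v)"
      using sec by blast
    then show "h (\<phi> v) = Some (q v)" "g (q v) = Some (\<phi> v)"
      by (simp_all add: q_def)
  qed
  have q_inj: "inj_on q (ran f)"
  proof (rule inj_onI)
    fix v w assume "v \<in> ran f" "w \<in> ran f" "q v = q w"
    then have "\<phi> v = \<phi> w"
      using q(2) by (metis option.inject)
    then show "v = w"
      using \<phi>(2) \<open>v \<in> ran f\<close> \<open>w \<in> ran f\<close> by (simp add: inj_on_eq_iff)
  qed
  have q_ran: "q ` ran f \<subseteq> ran h"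
    using q(1) ranI[of h] by blast
  note fib_f = fibers_labelled_matching[OF G f subset_refl]
  note fib_h = fibers_labelled_matching[OF G h q_ran]
  have fib_inj: "inj_on (\<lambda>v. preimage h {q v}) (ran f)"
    using comp_inj_on[OF q_inj fib_h(1)] by (simp add: comp_def)
  have fib_match: "matching E ((\<lambda>v. preimage h {q v}) ` ran f)"
    using fib_h(2) by (simp add: image_image)
  have ind: "independent_set V E ((\<lambda>v. v) ` ran f)"
    using St_independent_ran[OF G f] by simp
  define s where "s = matching_map (ran f) (\<lambda>v. preimage f {v}) q"
  define t where "t = matching_map (ran f) (\<lambda>v. preimage h {q v}) (\<lambda>v. v)"
  have s_iff: "s x = Some y \<longleftrightarrow> (\<exists>v\<in>ran f. x \<in> preimage f {v} \<and> y = q v)" for x y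
    unfolding s_def using fib_f by (intro matching_map_Some_iff) (simp_all add: matching_def)
  have t_iff: "t x = Some y \<longleftrightarrow> (\<exists>v\<in>ran f. x \<in> preimage h {q v} \<and> y = v)" for x y
    unfolding t_def using fib_inj fib_match
    by (intro matching_map_Some_iff) (simp_all add: matching_def)
  have "s \<in> St V E"
    unfolding s_def
    by (rule matching_map_in_St[OF G fib_f q_inj St_independent_ran[OF G h q_ran]])
  moreover have "t \<in> St V E"
    unfolding t_def by (rule matching_map_in_St[OF G fib_inj fib_match inj_on_id2 ind])
  moreover have "f = rcomp (rcomp s g) t"
  proof
    fix x
    show "f x = rcomp (rcomp s g) t x"
    proof (cases "f x")
      case None
      then have "s x = None"
        using s_iff[of x] by (cases "s x") (auto simp: preimage_def)
      then show ?thesis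
        using None by (simp add: rcomp_def map_comp_def)
    next
      case (Some v)
      then have v: "v \<in> ran f"
        by (rule ranI)
      have "s x = Some (q v)"
        using Some v by (auto simp: s_iff preimage_def)
      moreover have "t (\<phi> v) = Some v"
        using q(1)[OF v] v by (auto simp: t_iff preimage_def)
      ultimately show ?thesis
        using Some q(2)[OF v] by (simp add: rcomp_def map_comp_def)
    qed
  qed
  ultimately show ?thesis
    by blast
qed

text \<open>
  Regularity is asked of \<open>g\<close> because \<open>g\<close> is the element that has to occur as a factor.
\<close>

lemma principal_ideal_subset_iff_rank:
  assumes G: "finite_simple_graph V E"
    and f: "f \<in> St V E" and g: "regular_element (St V E) rcomp g"
  shows "principal_ideal (St V E) rcomp f \<subseteq> principal_ideal (St V E) rcomp g \<longleftrightarrow>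
    rank f \<le> rank g"
proof
  assume "principal_ideal (St V E) rcomp f \<subseteq> principal_ideal (St V E) rcomp g"
  then have "f \<in> principal_ideal (St V E) rcomp g"
    using principal_ideal_refl by (rule subsetD)
  then show "rank f \<le> rank g"
    using rank_le_of_mem_principal_ideal[OF G] g by (auto simp: regular_element_def)
next
  assume "rank f \<le> rank g"
  then have "f \<in> principal_ideal (St V E) rcomp g"
    using factor_through_regular[OF G f g] by (auto simp: principal_ideal_def)
  then show "principal_ideal (St V E) rcomp f \<subseteq> principal_ideal (St V E) rcomp g"
    using St_closed[OF G] by (intro principal_ideal_mono) (simp_all add: rcomp_assoc)
qed

section \<open>The chain of regular J-classes\<close>

lemma J_class_eq_iff:
  assumes "a \<in> S"
  shows "J_class S m a = J_class S m b \<longleftrightarrow> principal_ideal S m a = principal_ideal S m b"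
  using assms by (auto simp: J_class_def)

text \<open>
  A regular class is named after any of its members, in particular after a regular one; this
  reduces statements about classes to statements about regular elements.
\<close>

lemma regular_J_classes_eq_image:
  "regular_J_classes S m = J_class S m ` {c. regular_element S m c}"
proof (intro equalityI subsetI)
  fix C assume "C \<in> regular_J_classes S m"
  then obtain a c where "a \<in> S" "C = J_class S m a" "c \<in> C" "regular_element S m c"
    by (auto simp: regular_J_classes_def)
  then show "C \<in> J_class S m ` {c. regular_element S m c}"
    by (auto simp: J_class_def)
next
  fix C assume "C \<in> J_class S m ` {c. regular_element S m c}"
  then show "C \<in> regular_J_classes S m"
    unfolding regular_J_classes_def by (force simp: J_class_def regular_element_def)
qed

lemma regular_J_class_eq_iff_rank:
  assumes G: "finite_simple_graph V E"
    and f: "regular_element (St V E) rcomp f" and g: "regular_element (St V E) rcomp g"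
  shows "J_class (St V E) rcomp f = J_class (St V E) rcomp g \<longleftrightarrow> rank f = rank g"
proof -
  have S: "f \<in> St V E" "g \<in> St V E"
    using f g by (simp_all add: regular_element_def)
  show ?thesis
    using principal_ideal_subset_iff_rank[OF G S(1) g] principal_ideal_subset_iff_rank[OF G S(2) f]
    by (auto simp: J_class_eq_iff[OF S(1)])
qed

lemma regular_ranks:
  assumes G: "finite_simple_graph V E"
  shows "rank ` {f. regular_element (St V E) rcomp f} = {0..Max (TC_CC_ranks V E)}"
proof -
  have eq: "rank ` {f. regular_element (St V E) rcomp f} = TC_CC_ranks V E"
    by (auto simp: regular_iff_conditions[OF G] TC_CC_ranks_def)
  have fin: "finite (TC_CC_ranks V E)"
    using G by (intro finite_TC_CC_ranks) (simp add: finite_simple_graph_def)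
  then have "Max (TC_CC_ranks V E) \<in> TC_CC_ranks V E"
    using zero_in_TC_CC_ranks by (intro Max_in) auto
  then obtain f where "regular_element (St V E) rcomp f" "rank f = Max (TC_CC_ranks V E)"
    unfolding eq[symmetric] by auto
  then have "n \<in> rank ` {f. regular_element (St V E) rcomp f}" if "n \<le> Max (TC_CC_ranks V E)" for n
    using regular_of_smaller_rank[OF G, of f n] that by auto
  then show ?thesis
    using eq fin by auto
qed

theorem theorem7p2:
  fixes V :: "'a set" and E :: "'a set set"
  assumes "finite_simple_graph V E"
  defines "k \<equiv> Max (TC_CC_ranks V E)"
  shows "(\<exists>J :: nat \<Rightarrow> ('a \<rightharpoonup> 'a) set.
            regular_J_classes (St V E) rcomp = J ` {0..k} \<and>
            (\<forall>i j. i < j \<and> j \<le> k \<longrightarrow> J_class_less (St V E) rcomp (J i) (J j))) \<and>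
         (\<forall>f g. regular_element (St V E) rcomp f \<and> regular_element (St V E) rcomp g \<longrightarrow>
            (J_class (St V E) rcomp f = J_class (St V E) rcomp g \<longleftrightarrow>
             card (underlying_matching f) = card (underlying_matching g)))"
proof -
  note G = assms(1)
  let ?reg = "regular_element (St V E) rcomp" and ?J = "J_class (St V E) rcomp"
  have ranks: "rank ` {f. ?reg f} = {0..k}"
    unfolding k_def by (rule regular_ranks[OF G])
  have "\<forall>i\<in>{0..k}. \<exists>f. ?reg f \<and> rank f = i"
    unfolding ranks[symmetric] by blast
  from bchoice[OF this] obtain r where "\<forall>i\<in>{0..k}. ?reg (r i) \<and> rank (r i) = i"
    by blast
  then have r: "?reg (r i) \<and> rank (r i) = i" if "i \<le> k" for i
    using that by simp
  have "regular_J_classes (St V E) rcomp = (\<lambda>i. ?J (r i)) ` {0..k}"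
  proof -
    have eq: "?J (r (rank f)) = ?J f" and le: "rank f \<in> {0..k}" if "?reg f" for f
    proof -
      show le: "rank f \<in> {0..k}"
        using that ranks by blast
      then have "?reg (r (rank f))" "rank (r (rank f)) = rank f"
        using r by simp_all
      then show "?J (r (rank f)) = ?J f"
        using regular_J_class_eq_iff_rank[OF G _ that] by blast
    qed
    show ?thesis
      unfolding regular_J_classes_eq_image
    proof (intro equalityI image_subsetI)
      fix f assume "f \<in> {f. ?reg f}"
      then show "?J f \<in> (\<lambda>i. ?J (r i)) ` {0..k}"
        using eq[of f, symmetric] le[of f] by blast
    qed (use r in simp)
  qed
  moreover have "J_class_less (St V E) rcomp (?J (r i)) (?J (r j))" if "i < j" "j \<le> k" for i j
  proof -
    have ri: "?reg (r i)" "rank (r i) = i" and rj: "?reg (r j)" "rank (r j) = j"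
      using r that by auto
    have S: "r i \<in> St V E" "r j \<in> St V E"
      using ri rj by (simp_all add: regular_element_def)
    have "principal_ideal (St V E) rcomp (r i) \<subseteq> principal_ideal (St V E) rcomp (r j)"
      using principal_ideal_subset_iff_rank[OF G S(1) rj(1)] ri rj that by simp
    moreover have "?J (r i) \<noteq> ?J (r j)"
      using regular_J_class_eq_iff_rank[OF G ri(1) rj(1)] ri rj that by simp
    ultimately show ?thesis
      using S unfolding J_class_less_def J_class_le_def by blast
  qed
  ultimately show ?thesis
    using regular_J_class_eq_iff_rank[OF G]
    unfolding card_underlying_matching by (intro conjI exI[of _ "\<lambda>i. ?J (r i)"]) blast+
qed

end
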